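(* Let $G$ be a MAP topological abelian group. Then the following are equivalent: (a) Every countable subgroup $H \le G$ is of the form $s_{\underline{u}}(G)$ for some sequence $\underline{u} : \omega \to \widehat{G}$. (b) Some countable subgroup $H \le G$ is of the form $s_{\underline{u}}(G)$ for some sequence $\underline{u} : \omega \to \widehat{G}$. (c) $G^+$ has countable pseudocharacter.
   Context: Abelian groups are written additively; topological groups are Hausdorff. "Countable" means finite or countably infinite. $\mathbb{T} = \mathbb{R}/\mathbb{Z}$, and $\omega$ is the set of natural numbers. For a topological abelian group $G$, $\widehat{G}$ is the group of continuous homomorphisms $G \to \mathbb{T}$. For a sequence $\underline{u} = \langle u_n : n \in \omega\rangle$ in $\widehat{G}$, $s_{\underline{u}}(G) = \{x \in G : u_n(x) \to 0 \text{ in } \mathbb{T}\}$. $G^+$ denotes the group $G$ with its Bohr modification topology, i.e., the coarsest topology making all elements of $\widehat{G}$ continuous. $G$ is MAP (maximally almost periodic) if $G^+$ is Hausdorff. A topological space has countable pseudocharacter iff every singleton $\{x\}$ is a $G_\delta$ set. *)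

theory Defs
  imports "HOL-Analysis.Analysis"
begin

quotient_type real_mod_int = real / "\<lambda>x y :: real. x - y \<in> \<int>"
  morphisms rep_real_mod_int proj_real_mod_int
proof (rule equivpI)
  show "reflp (\<lambda>x y :: real. x - y \<in> \<int>)"
    by (simp add: reflp_def)
  show "symp (\<lambda>x y :: real. x - y \<in> \<int>)"
    by (metis (no_types, lifting) Ints_minus minus_diff_eq sympI)
  show "transp (\<lambda>x y :: real. x - y \<in> \<int>)"
  proof (rule transpI)
    fix x y z :: real
    assume "x - y \<in> \<int>" "y - z \<in> \<int>"
    then have "(x - y) + (y - z) \<in> \<int>" by (rule Ints_add)
    then show "x - z \<in> \<int>" by simp
  qed
qed

instantiation real_mod_int :: ab_group_add
begin

lift_definition zero_real_mod_int :: real_mod_int is "0 :: real" .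

lift_definition plus_real_mod_int :: "real_mod_int \<Rightarrow> real_mod_int \<Rightarrow> real_mod_int"
  is "(+) :: real \<Rightarrow> real \<Rightarrow> real"
  by (metis Ints_add add_diff_add)

lift_definition uminus_real_mod_int :: "real_mod_int \<Rightarrow> real_mod_int"
  is "uminus :: real \<Rightarrow> real"
  by (metis Ints_minus minus_diff_minus)

lift_definition minus_real_mod_int :: "real_mod_int \<Rightarrow> real_mod_int \<Rightarrow> real_mod_int"
  is "(-) :: real \<Rightarrow> real \<Rightarrow> real"
  by (smt (verit) Ints_diff)

instance
  by standard (transfer; simp)+

end

text \<open>The quotient topology induced by the projection from the real line.\<close>

instantiation real_mod_int :: topological_space
begin

definition open_real_mod_int :: "real_mod_int set \<Rightarrow> bool"
  where "open_real_mod_int U \<longleftrightarrow> open (proj_real_mod_int -` U)"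

instance
proof
  show "open (UNIV :: real_mod_int set)"
    by (simp add: open_real_mod_int_def)
  show "open (S \<inter> T)" if "open S" "open T" for S T :: "real_mod_int set"
    using that by (auto simp: open_real_mod_int_def)
  show "open (\<Union>K)" if "\<forall>S\<in>K. open S" for K :: "real_mod_int set set"
    using that by (auto simp: open_real_mod_int_def vimage_Union)
qed

end

lemma proj_real_mod_int_eq_iff: "proj_real_mod_int x = proj_real_mod_int y \<longleftrightarrow> x - y \<in> \<int>"
  by (rule real_mod_int.abs_eq_iff)

lemma proj_real_mod_int_surj: "\<exists>x. a = proj_real_mod_int x"
  by (metis Quotient_abs_rep Quotient_real_mod_int)

lemma open_proj_real_mod_int_image:
  assumes "open V"
  shows "open (proj_real_mod_int ` V)"
proof -
  have "proj_real_mod_int -` proj_real_mod_int ` V = (\<Union>k\<in>\<int>. (\<lambda>x. k + x) ` V)"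
    by (force simp: proj_real_mod_int_eq_iff image_iff)
  then show ?thesis
    using assms by (simp add: open_real_mod_int_def open_UN open_translation)
qed

lemma nhds_proj_real_mod_int:
  "nhds (proj_real_mod_int x) = filtermap proj_real_mod_int (nhds x)"
proof (rule filter_eqI)
  fix P :: "real_mod_int \<Rightarrow> bool"
  show "eventually P (nhds (proj_real_mod_int x))
      \<longleftrightarrow> eventually P (filtermap proj_real_mod_int (nhds x))"
  proof
    assume "eventually P (nhds (proj_real_mod_int x))"
    then obtain U where "open U" "proj_real_mod_int x \<in> U" "\<forall>y\<in>U. P y"
      by (auto simp: eventually_nhds)
    then show "eventually P (filtermap proj_real_mod_int (nhds x))"
      unfolding eventually_filtermap eventually_nhds
      by (intro exI[of _ "proj_real_mod_int -` U"]) (auto simp: open_real_mod_int_def)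
  next
    assume "eventually P (filtermap proj_real_mod_int (nhds x))"
    then obtain V where "open V" "x \<in> V" "\<forall>y\<in>V. P (proj_real_mod_int y)"
      by (auto simp: eventually_filtermap eventually_nhds)
    then show "eventually P (nhds (proj_real_mod_int x))"
      unfolding eventually_nhds
      by (intro exI[of _ "proj_real_mod_int ` V"]) (auto intro: open_proj_real_mod_int_image)
  qed
qed

instance real_mod_int :: topological_ab_group_add
proof
  fix a b :: real_mod_int
  obtain x y where xy: "a = proj_real_mod_int x" "b = proj_real_mod_int y"
    using proj_real_mod_int_surj by meson
  have proj: "filterlim proj_real_mod_int (nhds (proj_real_mod_int z)) (nhds z)" for z
    by (simp add: filterlim_def nhds_proj_real_mod_int)
  have "((\<lambda>p. proj_real_mod_int (fst p + snd p)) \<longlongrightarrow> proj_real_mod_int (x + y)) (nhds x \<times>\<^sub>F nhds y)"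
    using tendsto_add_Pair[of x y] by (intro filterlim_compose[OF proj]) (simp add: case_prod_unfold)
  then show "((\<lambda>p. fst p + snd p) \<longlongrightarrow> a + b) (nhds a \<times>\<^sub>F nhds b)"
    unfolding xy nhds_proj_real_mod_int[of x] nhds_proj_real_mod_int[of y]
    by (simp add: filterlim_filtermap prod_filtermap1 prod_filtermap2 filtermap_filtermap
        plus_real_mod_int.abs_eq)
next
  fix a :: real_mod_int
  obtain x where x: "a = proj_real_mod_int x"
    using proj_real_mod_int_surj by meson
  have proj: "filterlim proj_real_mod_int (nhds (proj_real_mod_int z)) (nhds z)" for z
    by (simp add: filterlim_def nhds_proj_real_mod_int)
  have "((\<lambda>z. proj_real_mod_int (- z)) \<longlongrightarrow> proj_real_mod_int (- x)) (nhds x)"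
    by (rule filterlim_compose[OF proj tendsto_uminus_nhds])
  then show "(uminus \<longlongrightarrow> - a) (nhds a)"
    unfolding x nhds_proj_real_mod_int[of x]
    by (simp add: filterlim_filtermap uminus_real_mod_int.abs_eq)
qed

definition characters :: "('a :: topological_ab_group_add \<Rightarrow> real_mod_int) set"
  where "characters = {f. Modules.additive f \<and> continuous_on UNIV f}"

definition add_subgroup :: "'a :: ab_group_add set \<Rightarrow> bool"
  where "add_subgroup H \<longleftrightarrow> 0 \<in> H \<and> (\<forall>x\<in>H. \<forall>y\<in>H. x + y \<in> H) \<and> (\<forall>x\<in>H. - x \<in> H)"

definition char_seq_null :: "(nat \<Rightarrow> 'a :: topological_ab_group_add \<Rightarrow> real_mod_int) \<Rightarrow> 'a set"
  where "char_seq_null u = {x. (\<lambda>n. u n x) \<longlonglongrightarrow> 0}"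

definition bohr_topology :: "'a :: topological_ab_group_add topology"
  where "bohr_topology = topology_generated_by {f -` U | f U. f \<in> characters \<and> open U}"

lemma topspace_bohr_topology [simp]:
  "topspace (bohr_topology :: 'a :: topological_ab_group_add topology) = UNIV"
proof -
  have "(\<lambda>_. 0) \<in> (characters :: ('a \<Rightarrow> real_mod_int) set)"
    by (simp add: characters_def Modules.additive_def)
  then have "UNIV \<in> {f -` U | f U. f \<in> (characters :: ('a \<Rightarrow> real_mod_int) set) \<and> open U}"
    by (force intro: open_UNIV)
  then show ?thesis
    unfolding bohr_topology_def topology_generated_by_topspace by blast
qed

lemma continuous_map_bohr_topology:
  "f \<in> characters \<Longrightarrow> continuous_map bohr_topology euclidean f"
  unfolding continuous_map_def topspace_bohr_topology
  by (auto simp: bohr_topology_def vimage_def intro!: topology_generated_by_Basis)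

lemma bohr_topology_coarsest:
  fixes X :: "'a :: topological_ab_group_add topology"
  assumes "topspace X = UNIV"
    and "\<And>f. f \<in> characters \<Longrightarrow> continuous_map X euclidean f"
    and "openin bohr_topology U"
  shows "openin X U"
proof -
  have "openin X (f -` V)" if "f \<in> characters" "open V" for f V
    using assms(1) assms(2)[OF that(1)] that(2) by (auto simp: continuous_map_def vimage_def)
  then show ?thesis
    using assms(3) generate_topology_on_coarsest[OF istopology_openin[of X]]
    unfolding bohr_topology_def openin_topology_generated_by_iff by (smt (verit) mem_Collect_eq)
qed

definition countable_pseudocharacter :: "'a topology \<Rightarrow> bool"
  where "countable_pseudocharacter X \<longleftrightarrow> (\<forall>x\<in>topspace X. gdelta_in X {x})"

end

theory Submission
  imports Defs "HOL-Real_Asymp.Real_Asymp"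
begin

text \<open>
  Both conditions on characterized subgroups are linked to countable pseudocharacter through the
  existence of countably many characters \<open>a\<^sub>0, a\<^sub>1, \<dots>\<close> separating the points of \<open>G\<close>.
  Given these, let \<open>h\<^sub>0, h\<^sub>1, \<dots>\<close> enumerate a countable subgroup \<open>H\<close>.
  A quantitative form of Bohr duality holds: for every \<open>n\<close> there is a \<^emph>\<open>finite\<close> \<open>P\<^sub>n \<subseteq> H\<close> such that a
  point where all characters that are small on \<open>h\<^sub>0, \<dots>, h\<^bsub>n-1\<^esub>\<close> are not too large must lie
  in \<open>P\<^sub>n\<close>, and a finite set \<open>E\<^sub>n\<close> of such characters suffices to conclude that the point is as
  close to \<open>P\<^sub>n\<close> as we like. Demanding closeness finer than the gaps between \<open>P\<^sub>n\<close> and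
  \<open>P\<^bsub>n+1\<^esub>\<close>, the approximating points of \<open>P\<^sub>n\<close> become constant, so that a point that is tested
  small by almost all \<open>E\<^sub>n\<close> belongs to \<open>H\<close>. The sequence \<open>u\<close> enumerates the sets \<open>E\<^sub>n\<close>.
\<close>

section \<open>The circle as unit complex numbers, with chordal distance\<close>

lift_definition circle_exp :: "real_mod_int \<Rightarrow> complex" is "\<lambda>x. cis (2 * pi * x)"
proof -
  fix x y :: real
  assume "x - y \<in> \<int>"
  then obtain n where "x - y = of_int n" by (auto elim: Ints_cases)
  then have "x = y + of_int n" by simp
  then have "2 * pi * x = 2 * pi * y + 2 * pi * of_int n"
    by (simp add: distrib_left)
  then show "cis (2 * pi * x) = cis (2 * pi * y)"
    by (simp add: cis_mult[symmetric] cis_multiple_2pi)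
qed

lemma circle_exp_0 [simp]: "circle_exp 0 = 1"
  by transfer simp

lemma circle_exp_add: "circle_exp (s + t) = circle_exp s * circle_exp t"
  by transfer (simp add: cis_mult algebra_simps)

lemma circle_exp_minus: "circle_exp (- t) = cnj (circle_exp t)"
  by transfer (simp add: cis_cnj)

lemma circle_exp_diff: "circle_exp (s - t) = circle_exp s * cnj (circle_exp t)"
  using circle_exp_add[of s "- t"] by (simp add: circle_exp_minus)

lemma norm_circle_exp [simp]: "cmod (circle_exp t) = 1"
  by transfer simp

lemma circle_exp_sum: "circle_exp (sum f A) = (\<Prod>i\<in>A. circle_exp (f i))"
  by (induction A rule: infinite_finite_induct) (auto simp: circle_exp_add)

text \<open>An explicit left inverse of \<open>circle_exp\<close>. It yields injectivity, and
  through continuity of \<open>Arg\<close> at 1 it brings convergence back from the complex plane to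
  the quotient.\<close>

lemma proj_Arg_circle_exp: "proj_real_mod_int (Arg (circle_exp t) / (2 * pi)) = t"
proof -
  obtain x where x: "t = proj_real_mod_int x"
    using proj_real_mod_int_surj by blast
  have e: "circle_exp t = cis (2 * pi * x)"
    unfolding x by transfer simp
  have "cis (Arg (circle_exp t)) = cis (2 * pi * x)"
    using cis_Arg[of "circle_exp t"] e by (simp add: sgn_div_norm)
  then have "cis (Arg (circle_exp t) - 2 * pi * x) = 1"
    by (simp add: cis_divide[symmetric])
  then have "cos (Arg (circle_exp t) - 2 * pi * x) = 1"
    by (simp add: complex_eq_iff)
  then obtain n :: int where "Arg (circle_exp t) - 2 * pi * x = of_int n * 2 * pi"
    using cos_one_2pi_int by auto
  then have "Arg (circle_exp t) / (2 * pi) - x = of_int n"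
    by (simp add: field_simps)
  then show ?thesis
    unfolding x by (simp add: proj_real_mod_int_eq_iff)
qed

lemma continuous_on_circle_exp: "continuous_on UNIV circle_exp"
proof -
  have "(circle_exp \<longlongrightarrow> circle_exp t) (nhds t)" for t
  proof -
    obtain x where x: "t = proj_real_mod_int x"
      using proj_real_mod_int_surj by blast
    have eq: "circle_exp (proj_real_mod_int y) = cis (2 * pi * y)" for y
      by transfer simp
    have "isCont (\<lambda>y. cis (2 * pi * y)) x"
      unfolding cis_conv_exp by (intro continuous_intros)
    then have "((\<lambda>y. cis (2 * pi * y)) \<longlongrightarrow> cis (2 * pi * x)) (nhds x)"
      using tendsto_at_iff_tendsto_nhds[of "\<lambda>y. cis (2 * pi * y)" x] by (simp add: isCont_def)
    then show ?thesis
      unfolding x nhds_proj_real_mod_int filterlim_filtermap eq .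
  qed
  then show ?thesis
    unfolding continuous_on_def by (blast intro: filterlim_mono at_within_le_nhds)
qed

text \<open>Chord length from 0, which turns closeness in the quotient topology into inequalities
  between reals.\<close>

definition circle_dist :: "real_mod_int \<Rightarrow> real"
  where "circle_dist t = cmod (circle_exp t - 1)"

lemma circle_dist_nonneg [simp]: "circle_dist t \<ge> 0"
  by (simp add: circle_dist_def)

lemma circle_dist_eq_0_iff [simp]: "circle_dist t = 0 \<longleftrightarrow> t = 0"
proof
  assume "circle_dist t = 0"
  then have "circle_exp t = 1" by (simp add: circle_dist_def)
  then have "proj_real_mod_int 0 = t" using proj_Arg_circle_exp[of t] by simp
  then show "t = 0" by (simp add: zero_real_mod_int_def)
qed (simp add: circle_dist_def)

lemma circle_dist_0 [simp]: "circle_dist 0 = 0"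
  by simp

lemma circle_dist_diff: "circle_dist (s - t) = cmod (circle_exp s - circle_exp t)"
proof -
  have "circle_exp s - circle_exp t = (circle_exp (s - t) - 1) * circle_exp t"
    by (simp add: ring_distribs flip: circle_exp_add)
  then show ?thesis by (simp add: circle_dist_def norm_mult)
qed

lemma circle_dist_diff_le: "circle_dist (s - t) \<le> circle_dist s + circle_dist t"
  unfolding circle_dist_diff unfolding circle_dist_def
  by (metis dist_norm dist_triangle2)

lemma continuous_on_circle_dist: "continuous_on UNIV circle_dist"
  unfolding circle_dist_def by (intro continuous_intros continuous_on_circle_exp)

text \<open>For the converse, \<open>circle_exp (u n)\<close> tends to 1, away from the branch cut
  of \<open>Arg\<close>; so the real representatives tend to 0 and can be projected.\<close>

lemma tendsto_0_iff_circle_dist: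
  "u \<longlonglongrightarrow> 0 \<longleftrightarrow> (\<lambda>n. circle_dist (u n)) \<longlonglongrightarrow> 0"
proof
  assume "u \<longlonglongrightarrow> 0"
  then show "(\<lambda>n. circle_dist (u n)) \<longlonglongrightarrow> 0"
    using continuous_on_tendsto_compose[OF continuous_on_circle_dist, of u 0 sequentially] by simp
next
  assume "(\<lambda>n. circle_dist (u n)) \<longlonglongrightarrow> 0"
  then have "(\<lambda>n. circle_exp (u n)) \<longlonglongrightarrow> 1"
    by (simp add: circle_dist_def tendsto_norm_zero_iff LIM_zero_iff)
  then have "(\<lambda>n. Arg (circle_exp (u n))) \<longlonglongrightarrow> Arg 1"
    by (rule isCont_tendsto_compose[OF continuous_at_Arg, rotated]) simp
  then have "(\<lambda>n. Arg (circle_exp (u n)) / (2 * pi)) \<longlonglongrightarrow> 0"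
    using tendsto_divide_zero by simp
  then have "(\<lambda>n. proj_real_mod_int (Arg (circle_exp (u n)) / (2 * pi))) \<longlonglongrightarrow> proj_real_mod_int 0"
    by (rule filterlim_compose[rotated]) (simp add: filterlim_def nhds_proj_real_mod_int)
  then show "u \<longlonglongrightarrow> 0"
    by (simp add: proj_Arg_circle_exp zero_real_mod_int_def)
qed

section \<open>Algebra of characters and subgroups\<close>

lemma character_additive:
  assumes "f \<in> characters"
  shows "f (x + y) = f x + f y" and "f (x - y) = f x - f y" and "f 0 = 0"
proof -
  have "Modules.additive f" using assms by (simp add: characters_def)
  then show "f (x + y) = f x + f y" and "f (x - y) = f x - f y" and "f 0 = 0"
    by (rule Modules.additive.add Modules.additive.diff Modules.additive.zero)+
qed

lemma character_sum: "f \<in> characters \<Longrightarrow> f (sum g A) = (\<Sum>i\<in>A. f (g i))"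
  by (induction A rule: infinite_finite_induct) (auto simp: character_additive[of f])

lemma characters_diff:
  "f \<in> characters \<Longrightarrow> g \<in> characters \<Longrightarrow> (\<lambda>x. f x - g x) \<in> characters"
  by (auto simp: characters_def Modules.additive_def algebra_simps intro: continuous_on_diff)

lemma characters_sum:
  assumes "\<And>i. i \<in> A \<Longrightarrow> f i \<in> characters"
  shows "(\<lambda>x. \<Sum>i\<in>A. f i x) \<in> characters"
  using assms
  by (auto simp: characters_def Modules.additive_def sum.distrib intro: continuous_on_sum)

lemma add_subgroup_sum:
  assumes "add_subgroup H" "\<And>i. i \<in> A \<Longrightarrow> f i \<in> H"
  shows "sum f A \<in> H"
  using assms(2)
  by (induction A rule: infinite_finite_induct) (use assms(1) in \<open>auto simp: add_subgroup_def\<close>)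

lemma add_subgroup_diff: "add_subgroup H \<Longrightarrow> x \<in> H \<Longrightarrow> y \<in> H \<Longrightarrow> x - y \<in> H"
  unfolding add_subgroup_def by (metis diff_conv_add_uminus)

section \<open>Bohr topology and countable separation of points\<close>

text \<open>Induction over the generation of the open set: a subbasic set needs one character, an
  intersection merges two finite sets, and a union uses any member containing
  \<open>x\<close>.\<close>

lemma bohr_open_contains_kernel_coset:
  assumes "openin bohr_topology U" "x \<in> U"
  shows "\<exists>F. finite F \<and> F \<subseteq> characters \<and> (\<forall>y. (\<forall>f\<in>F. f y = f x) \<longrightarrow> y \<in> U)"
proof -
  have "generate_topology_on {f -` U | f U. f \<in> characters \<and> open U} U"
    using assms(1) by (simp add: bohr_topology_def openin_topology_generated_by_iff)
  then show ?thesis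
    using assms(2)
  proof (induction rule: generate_topology_on.induct)
    case Empty
    then show ?case by blast
  next
    case (Int a b)
    then have "x \<in> a" "x \<in> b" by blast+
    obtain F where F: "finite F" "F \<subseteq> characters" "\<And>y. (\<forall>f\<in>F. f y = f x) \<Longrightarrow> y \<in> a"
      using Int.IH(1)[OF \<open>x \<in> a\<close>] by blast
    obtain F' where F': "finite F'" "F' \<subseteq> characters" "\<And>y. (\<forall>f\<in>F'. f y = f x) \<Longrightarrow> y \<in> b"
      using Int.IH(2)[OF \<open>x \<in> b\<close>] by blast
    have "finite (F \<union> F')" "F \<union> F' \<subseteq> characters"
      using F(1,2) F'(1,2) by simp_all
    moreover have "\<forall>y. (\<forall>f\<in>F \<union> F'. f y = f x) \<longrightarrow> y \<in> a \<inter> b"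
      using F(3) F'(3) by blast
    ultimately show ?case by (intro exI[of _ "F \<union> F'"] conjI)
  next
    case (UN K)
    then obtain k where k: "k \<in> K" "x \<in> k" by blast
    obtain F where F: "finite F" "F \<subseteq> characters" "\<And>y. (\<forall>f\<in>F. f y = f x) \<Longrightarrow> y \<in> k"
      using UN.IH[OF k] by blast
    have "\<forall>y. (\<forall>f\<in>F. f y = f x) \<longrightarrow> y \<in> \<Union>K"
      using F(3) k(1) by blast
    with F(1,2) show ?case by (intro exI[of _ F] conjI)
  next
    case (Basis s)
    then obtain f V where f: "s = f -` V" "f \<in> characters" by blast
    with Basis.prems have "\<forall>y. (\<forall>f\<in>{f}. f y = f x) \<longrightarrow> y \<in> s"
      by simp
    with f(2) show ?case by (intro exI[of _ "{f}"] conjI) simp_all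
  qed
qed

text \<open>Countably many Bohr-open sets involve only countably many characters; if these vanish at
  \<open>y\<close>, then \<open>z + y\<close> stays in every set, so \<open>y = 0\<close>.
  Conversely, separating characters cut out \<open>{z}\<close> by countably many
  inequalities.\<close>

lemma bohr_gdelta_singleton_iff_countably_separated:
  fixes z :: "'a :: topological_ab_group_add"
  shows "gdelta_in bohr_topology {z} \<longleftrightarrow>
    (\<exists>a :: nat \<Rightarrow> 'a \<Rightarrow> real_mod_int. range a \<subseteq> characters \<and> (\<forall>y. (\<forall>n. a n y = 0) \<longrightarrow> y = 0))"
proof
  assume "gdelta_in bohr_topology {z}"
  then obtain \<U> where \<U>': "countable \<U>" "\<U> \<subseteq> Collect (openin bohr_topology)" "\<Inter>\<U> = {z}"
    unfolding gdelta_in_alt intersection_of_def by blast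
  then have \<U>: "countable \<U>" "\<And>U. U \<in> \<U> \<Longrightarrow> openin bohr_topology U" "\<Inter>\<U> = {z}"
    by blast+
  have "\<exists>F. finite F \<and> F \<subseteq> characters \<and> (\<forall>y. (\<forall>f\<in>F. f y = f z) \<longrightarrow> y \<in> U)" if "U \<in> \<U>" for U
    using \<U> that by (intro bohr_open_contains_kernel_coset) blast+
  then have "\<forall>U\<in>\<U>. \<exists>F. finite F \<and> F \<subseteq> characters \<and> (\<forall>y. (\<forall>f\<in>F. f y = f z) \<longrightarrow> y \<in> U)"
    by blast
  from bchoice[OF this] obtain F where F: "\<And>U. U \<in> \<U> \<Longrightarrow> finite (F U)"
    "\<And>U. U \<in> \<U> \<Longrightarrow> F U \<subseteq> characters"
    "\<And>U y. U \<in> \<U> \<Longrightarrow> (\<forall>f\<in>F U. f y = f z) \<Longrightarrow> y \<in> U"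
    by blast
  \<comment> \<open>The zero character keeps \<open>A\<close> nonempty, so that
    \<open>from_nat_into\<close> enumerates exactly \<open>A\<close>.\<close>
  define A where "A = insert (\<lambda>_. 0) (\<Union>U\<in>\<U>. F U)"
  have "countable A" "A \<noteq> {}"
    unfolding A_def using \<U>(1) F(1) by (blast intro: countable_insert countable_UN countable_finite)+
  then have range: "range (from_nat_into A) = A"
    by (simp add: range_from_nat_into)
  have A: "A \<subseteq> characters"
  proof -
    have "(\<lambda>_. 0) \<in> (characters :: ('a \<Rightarrow> real_mod_int) set)"
      by (simp add: characters_def Modules.additive_def)
    with F(2) show ?thesis unfolding A_def by blast
  qed
  have "y = 0" if "\<forall>n. from_nat_into A n y = 0" for y
  proof -
    have A0: "f y = 0" if "f \<in> A" for f
    proof -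
      from that range have "f \<in> range (from_nat_into A)" by simp
      with \<open>\<forall>n. from_nat_into A n y = 0\<close> show ?thesis by blast
    qed
    have "\<forall>f\<in>F U. f (z + y) = f z" if "U \<in> \<U>" for U
    proof
      fix f assume "f \<in> F U"
      with that F(2) have "f \<in> A" "f \<in> characters" by (auto simp: A_def)
      with A0 show "f (z + y) = f z"
        by (simp add: character_additive[of f])
    qed
    then have "\<And>U. U \<in> \<U> \<Longrightarrow> z + y \<in> U"
      using F(3) by blast
    then have "z + y \<in> \<Inter>\<U>" by blast
    then show ?thesis using \<U>(3) by simp
  qed
  then show "\<exists>a :: nat \<Rightarrow> 'a \<Rightarrow> real_mod_int. range a \<subseteq> characters \<and> (\<forall>y. (\<forall>n. a n y = 0) \<longrightarrow> y = 0)"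
    using A by (intro exI[of _ "from_nat_into A"] conjI allI impI) (simp_all only: range)
next
  assume "\<exists>a :: nat \<Rightarrow> 'a \<Rightarrow> real_mod_int. range a \<subseteq> characters \<and> (\<forall>y. (\<forall>n. a n y = 0) \<longrightarrow> y = 0)"
  then obtain a :: "nat \<Rightarrow> 'a \<Rightarrow> real_mod_int" where
    a: "\<And>n. a n \<in> characters" "\<And>y. (\<And>n. a n y = 0) \<Longrightarrow> y = 0"
    by auto
  \<comment> \<open>The index \<open>p\<close> is a pair: which character is tested, and with what
    precision.\<close>
  define U where "U p = {y. circle_dist (a (fst p) y - a (fst p) z) < 1 / Suc (snd p)}" for p
  have "openin bohr_topology (U p)" for p
  proof -
    let ?V = "{t. circle_dist (t - a (fst p) z) < 1 / Suc (snd p)}"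
    have "open ?V"
      by (intro open_Collect_less continuous_on_const continuous_on_diff continuous_on_id
          continuous_on_compose2[OF continuous_on_circle_dist, of UNIV] subset_UNIV)
    moreover have "U p = {y \<in> topspace bohr_topology. a (fst p) y \<in> ?V}"
      by (simp add: U_def)
    ultimately show ?thesis
      using openin_continuous_map_preimage[OF continuous_map_bohr_topology[OF a(1)], of ?V]
      by simp
  qed
  then have "gdelta_in bohr_topology (\<Inter> (range U))"
    using open_imp_gdelta_in by (intro gdelta_in_Inter) blast+
  moreover have "\<Inter> (range U) = {z}"
  proof
    show "\<Inter> (range U) \<subseteq> {z}"
    proof
      fix y assume y: "y \<in> \<Inter> (range U)"
      have "a n (y - z) = 0" for n
      proof -
        have "circle_dist (a n (y - z)) < 1 / Suc k" for k
          using y by (auto simp: U_def character_additive(2)[OF a(1)])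
        then have "\<not> circle_dist (a n (y - z)) > 0"
          by (metis nat_approx_posE less_asym)
        then show ?thesis
          using circle_dist_nonneg[of "a n (y - z)"] by simp
      qed
      then have "y - z = 0" by (rule a(2))
      then show "y \<in> {z}" by simp
    qed
    show "{z} \<subseteq> \<Inter> (range U)"
      by (auto simp: U_def circle_dist_def)
  qed
  ultimately show "gdelta_in bohr_topology {z}" by simp
qed

lemma exists_nonvanishing_character:
  fixes z :: "'a :: {topological_ab_group_add, t2_space}"
  assumes "Hausdorff_space (bohr_topology :: 'a topology)" "z \<noteq> 0"
  shows "\<exists>f\<in>characters. f z \<noteq> 0"
proof -
  obtain U V where "openin bohr_topology U" "0 \<in> U" "z \<in> V" "disjnt U V"
    using assms unfolding Hausdorff_space_def topspace_bohr_topology by (metis UNIV_I)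
  then have U: "openin bohr_topology U" "0 \<in> U" "z \<notin> U"
    by (auto simp: disjnt_iff)
  then obtain F where F: "F \<subseteq> characters" "\<And>y. (\<forall>f\<in>F. f y = f 0) \<Longrightarrow> y \<in> U"
    using bohr_open_contains_kernel_coset[OF U(1,2)] by blast
  then obtain f where f: "f \<in> F" "f z \<noteq> f 0"
    using U(3) by blast
  then have "f \<in> characters" using F by blast
  with f show ?thesis using character_additive(3)[of f] by auto
qed

section \<open>Averaging over pairs of characters\<close>

lemma norm_sum_square:
  fixes f :: "'a \<Rightarrow> complex"
  shows "of_real ((cmod (\<Sum>i\<in>A. f i))\<^sup>2) = (\<Sum>i\<in>A. \<Sum>j\<in>A. f i * cnj (f j))"
  unfolding complex_norm_square cnj_sum sum_product ..

text \<open>Expanding the squared moduli makes both sides the same fourfold sum: multiplicativity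
  merges the values at \<open>y\<close>, \<open>g j\<close> and \<open>g l\<close>, and only the
  order of summation differs.\<close>

lemma weighted_pair_average_identity:
  fixes \<phi> :: "'k \<Rightarrow> 'g :: ab_group_add \<Rightarrow> complex" and g :: "'j \<Rightarrow> 'g" and b :: "'j \<Rightarrow> real"
  assumes add: "\<And>\<kappa> y z. \<kappa> \<in> K \<Longrightarrow> \<phi> \<kappa> (y + z) = \<phi> \<kappa> y * \<phi> \<kappa> z"
    and diff: "\<And>\<kappa> y z. \<kappa> \<in> K \<Longrightarrow> \<phi> \<kappa> (y - z) = \<phi> \<kappa> y * cnj (\<phi> \<kappa> z)"
  shows "(\<Sum>\<kappa>\<in>K. \<Sum>\<mu>\<in>K. Re (\<phi> \<kappa> y * cnj (\<phi> \<mu> y))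
        * (cmod (\<Sum>j\<in>J. of_real (b j) * (\<phi> \<kappa> (g j) * cnj (\<phi> \<mu> (g j)))))\<^sup>2)
    = (\<Sum>j\<in>J. \<Sum>l\<in>J. b j * b l * (cmod (\<Sum>\<kappa>\<in>K. \<phi> \<kappa> (y + g j - g l)))\<^sup>2)"
proof -
  have "(\<Sum>\<kappa>\<in>K. \<Sum>\<mu>\<in>K. \<phi> \<kappa> y * cnj (\<phi> \<mu> y)
        * of_real ((cmod (\<Sum>j\<in>J. of_real (b j) * (\<phi> \<kappa> (g j) * cnj (\<phi> \<mu> (g j)))))\<^sup>2))
    = (\<Sum>\<kappa>\<in>K. \<Sum>\<mu>\<in>K. \<Sum>j\<in>J. \<Sum>l\<in>J. of_real (b j * b l)
        * (\<phi> \<kappa> (y + g j - g l) * cnj (\<phi> \<mu> (y + g j - g l))))"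
    unfolding norm_sum_square sum_distrib_left
    by (intro sum.cong refl) (simp add: add diff mult_ac)
  also have "\<dots> = (\<Sum>j\<in>J. \<Sum>l\<in>J. \<Sum>\<kappa>\<in>K. \<Sum>\<mu>\<in>K. of_real (b j * b l)
        * (\<phi> \<kappa> (y + g j - g l) * cnj (\<phi> \<mu> (y + g j - g l))))"
    unfolding sum.swap[of _ K J] ..
  also have "\<dots> = (\<Sum>j\<in>J. \<Sum>l\<in>J. of_real (b j * b l * (cmod (\<Sum>\<kappa>\<in>K. \<phi> \<kappa> (y + g j - g l)))\<^sup>2))"
    by (simp only: of_real_mult norm_sum_square sum_distrib_left)
  finally have "Re (\<Sum>\<kappa>\<in>K. \<Sum>\<mu>\<in>K. \<phi> \<kappa> y * cnj (\<phi> \<mu> y)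
        * of_real ((cmod (\<Sum>j\<in>J. of_real (b j) * (\<phi> \<kappa> (g j) * cnj (\<phi> \<mu> (g j)))))\<^sup>2))
    = Re (\<Sum>j\<in>J. \<Sum>l\<in>J. of_real (b j * b l * (cmod (\<Sum>\<kappa>\<in>K. \<phi> \<kappa> (y + g j - g l)))\<^sup>2))"
    by simp
  then show ?thesis
    unfolding Re_sum by simp
qed

text \<open>
  Averaging the identity above: where the kernel exceeds \<open>\<delta>\<close>, the factor
  \<open>\<phi> \<kappa> x * cnj (\<phi> \<mu> x)\<close> is positive, so its weighted average is at least half of the average of
  the kernel up to an error \<open>\<delta>\<close>. The latter is bounded below by the diagonal terms, and a convex
  combination is at most its largest term.
\<close>

lemma exists_large_character_sum:
  fixes \<phi> :: "'k \<Rightarrow> 'g :: ab_group_add \<Rightarrow> complex" and g :: "'j \<Rightarrow> 'g" and b :: "'j \<Rightarrow> real"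
  assumes J: "finite J"
    and add: "\<And>\<kappa> y z. \<kappa> \<in> K \<Longrightarrow> \<phi> \<kappa> (y + z) = \<phi> \<kappa> y * \<phi> \<kappa> z"
    and diff: "\<And>\<kappa> y z. \<kappa> \<in> K \<Longrightarrow> \<phi> \<kappa> (y - z) = \<phi> \<kappa> y * cnj (\<phi> \<kappa> z)"
    and unit: "\<And>\<kappa> y. \<kappa> \<in> K \<Longrightarrow> cmod (\<phi> \<kappa> y) = 1"
    and b: "\<And>j. j \<in> J \<Longrightarrow> b j \<ge> 0" "sum b J = 1"
    and \<delta>: "\<delta> \<ge> 0"
    and near: "\<And>\<kappa> \<mu>. \<kappa> \<in> K \<Longrightarrow> \<mu> \<in> K \<Longrightarrow> Re (\<phi> \<kappa> x * cnj (\<phi> \<mu> x)) \<ge> 1/2 \<or>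
        (cmod (\<Sum>j\<in>J. of_real (b j) * (\<phi> \<kappa> (g j) * cnj (\<phi> \<mu> (g j)))))\<^sup>2 \<le> \<delta>"
  shows "\<exists>j\<in>J. \<exists>l\<in>J. (1 / (2 * card J) - 3/2 * \<delta>) * (card K)\<^sup>2
      \<le> (cmod (\<Sum>\<kappa>\<in>K. \<phi> \<kappa> (x + g j - g l)))\<^sup>2"
proof -
  define q where "q \<kappa> \<mu> = (cmod (\<Sum>j\<in>J. of_real (b j) * (\<phi> \<kappa> (g j) * cnj (\<phi> \<mu> (g j)))))\<^sup>2" for \<kappa> \<mu>
  define S where "S y = (cmod (\<Sum>\<kappa>\<in>K. \<phi> \<kappa> y))\<^sup>2" for y
  have id: "(\<Sum>\<kappa>\<in>K. \<Sum>\<mu>\<in>K. Re (\<phi> \<kappa> y * cnj (\<phi> \<mu> y)) * q \<kappa> \<mu>)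
      = (\<Sum>j\<in>J. \<Sum>l\<in>J. b j * b l * S (y + g j - g l))" for y
    unfolding q_def S_def by (rule weighted_pair_average_identity[OF add diff])
  have "J \<noteq> {}" using b(2) by auto
  have \<phi>0: "\<phi> \<kappa> 0 = 1" if "\<kappa> \<in> K" for \<kappa>
    using diff[OF that, of 0 0] unit[OF that, of 0] by (simp add: complex_norm_square[symmetric])
  have re: "\<bar>Re (\<phi> \<kappa> x * cnj (\<phi> \<mu> x))\<bar> \<le> 1" if "\<kappa> \<in> K" "\<mu> \<in> K" for \<kappa> \<mu>
    using abs_Re_le_cmod[of "\<phi> \<kappa> x * cnj (\<phi> \<mu> x)"] unit that by (simp add: norm_mult)
  have "(card K)\<^sup>2 / card J \<le> (\<Sum>j\<in>J. (b j)\<^sup>2) * (card K)\<^sup>2"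
  proof -
    \<comment> \<open>Cauchy-Schwarz applied to the weights \<open>b\<close>, whose sum is
      1.\<close>
    have "1 / card J \<le> (\<Sum>j\<in>J. (b j)\<^sup>2)"
      using sum_squared_le_sum_of_squares[of b J] b(2) \<open>J \<noteq> {}\<close> J
      by (simp add: divide_le_eq card_gt_0_iff)
    from mult_right_mono[OF this, of "(card K)\<^sup>2"] show ?thesis by simp
  qed
  also have "\<dots> = (\<Sum>j\<in>J. b j * b j * S (0 + g j - g j))"
    by (simp add: S_def \<phi>0 sum_distrib_right power2_eq_square)
  also have "\<dots> \<le> (\<Sum>j\<in>J. \<Sum>l\<in>J. b j * b l * S (0 + g j - g l))"
  proof (rule sum_mono)
    fix j assume "j \<in> J"
    then show "b j * b j * S (0 + g j - g j) \<le> (\<Sum>l\<in>J. b j * b l * S (0 + g j - g l))"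
      using b(1) J by (intro member_le_sum[where f = "\<lambda>l. b j * b l * S (0 + g j - g l)"])
        (auto simp: S_def)
  qed
  \<comment> \<open>The averaging identity at the point 0, where every
    \<open>\<phi> \<kappa>\<close> equals 1.\<close>
  also have "\<dots> = (\<Sum>\<kappa>\<in>K. \<Sum>\<mu>\<in>K. q \<kappa> \<mu>)"
    unfolding id[symmetric] by (intro sum.cong refl) (simp add: \<phi>0)
  finally have low: "(card K)\<^sup>2 / card J \<le> (\<Sum>\<kappa>\<in>K. \<Sum>\<mu>\<in>K. q \<kappa> \<mu>)" .
  \<comment> \<open>Where the real part may be below 1/2 it is still at least -1, and
    \<open>q \<le> \<delta>\<close> gives \<open>- q \<ge> q/2 - 3/2 * \<delta>\<close>; this is the
    source of the factor 3/2.\<close>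
  have "1/2 * q \<kappa> \<mu> - 3/2 * \<delta> \<le> Re (\<phi> \<kappa> x * cnj (\<phi> \<mu> x)) * q \<kappa> \<mu>" if "\<kappa> \<in> K" "\<mu> \<in> K" for \<kappa> \<mu>
  proof -
    have q0: "q \<kappa> \<mu> \<ge> 0" by (simp add: q_def)
    show ?thesis
    proof (cases "Re (\<phi> \<kappa> x * cnj (\<phi> \<mu> x)) \<ge> 1/2")
      case True
      then show ?thesis using mult_right_mono[OF True q0] \<delta> by linarith
    next
      case False
      then have "q \<kappa> \<mu> \<le> \<delta>" using near[OF that] by (simp add: q_def)
      moreover have "- 1 * q \<kappa> \<mu> \<le> Re (\<phi> \<kappa> x * cnj (\<phi> \<mu> x)) * q \<kappa> \<mu>"
        using re[OF that] q0 by (intro mult_right_mono) linarith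
      ultimately show ?thesis by linarith
    qed
  qed
  then have "(\<Sum>\<kappa>\<in>K. \<Sum>\<mu>\<in>K. 1/2 * q \<kappa> \<mu> - 3/2 * \<delta>)
      \<le> (\<Sum>j\<in>J. \<Sum>l\<in>J. b j * b l * S (x + g j - g l))"
    unfolding id[symmetric] by (intro sum_mono) 
  moreover have "(\<Sum>\<kappa>\<in>K. \<Sum>\<mu>\<in>K. 1/2 * q \<kappa> \<mu> - 3/2 * \<delta>)
      = 1/2 * (\<Sum>\<kappa>\<in>K. \<Sum>\<mu>\<in>K. q \<kappa> \<mu>) - 3/2 * \<delta> * (card K)\<^sup>2"
    by (simp add: sum_subtractf sum_distrib_left power2_eq_square)
  moreover have "(1 / (2 * card J) - 3/2 * \<delta>) * (card K)\<^sup>2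
      = 1/2 * ((card K)\<^sup>2 / card J) - 3/2 * \<delta> * (card K)\<^sup>2"
    by (simp add: algebra_simps)
  ultimately have *: "(1 / (2 * card J) - 3/2 * \<delta>) * (card K)\<^sup>2
      \<le> (\<Sum>j\<in>J. \<Sum>l\<in>J. b j * b l * S (x + g j - g l))"
    using low by linarith
  define R where "R = (\<lambda>(j, l). S (x + g j - g l)) ` (J \<times> J)"
  have R: "finite R" "R \<noteq> {}" using J \<open>J \<noteq> {}\<close> by (auto simp: R_def)
  have "(\<Sum>j\<in>J. \<Sum>l\<in>J. b j * b l * S (x + g j - g l)) \<le> (\<Sum>j\<in>J. \<Sum>l\<in>J. b j * b l * Max R)"
    using b(1) R(1) by (intro sum_mono mult_left_mono Max_ge) (auto simp: R_def)
  also have "\<dots> = Max R"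
    by (simp add: sum_distrib_right[symmetric] sum_distrib_left[symmetric] b(2))
  finally have "(1 / (2 * card J) - 3/2 * \<delta>) * (card K)\<^sup>2 \<le> Max R"
    using * by linarith
  moreover have "Max R \<in> R" using R by simp
  then obtain j l where "j \<in> J" "l \<in> J" "Max R = S (x + g j - g l)"
    unfolding R_def by auto
  ultimately show ?thesis unfolding S_def by auto
qed

section \<open>Binomial kernels, box sums and finite sets of test characters\<close>

text \<open>The binomial theorem in each factor, followed by distributivity. The coefficients are
  product binomial probabilities, hence admissible as the weights \<open>b\<close>.\<close>

lemma prod_binomial_average:
  fixes z :: "nat \<Rightarrow> complex"
  shows "(\<Prod>i<m. ((1 + z i) / 2) ^ N) = (\<Sum>j\<in>PiE {..<m} (\<lambda>_. {..N}).
    of_real (\<Prod>i<m. real (N choose j i) / 2 ^ N) * (\<Prod>i<m. z i ^ j i))"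
proof -
  have "((1 + z i) / 2) ^ N = (\<Sum>k\<le>N. of_real (real (N choose k) / 2 ^ N) * z i ^ k)" for i
    using binomial_ring[of "z i" 1 N] by (simp add: power_divide sum_divide_distrib add.commute)
  then show ?thesis
    by (simp only: prod_sum_PiE[OF finite_lessThan finite_atMost] prod.distrib of_real_prod)
qed

lemma sum_prod_binomial: "(\<Sum>j\<in>PiE {..<m::nat} (\<lambda>_. {..N}). \<Prod>i<m. real (N choose j i) / 2 ^ N) = 1"
proof -
  have "(\<Sum>k\<le>N. real (N choose k) / 2 ^ N) = 1"
    using choose_row_sum[of N] by (simp add: sum_divide_distrib[symmetric] flip: of_nat_sum)
  then show ?thesis
    using prod_sum_PiE[of "{..<m}" "\<lambda>_. {..N}" "\<lambda>_ k. real (N choose k) / 2 ^ N"] by simp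
qed

text \<open>On the unit circle the squared moduli of \<open>1 + z\<close> and \<open>z - 1\<close>
  are 2 + 2 Re z and 2 - 2 Re z.\<close>

lemma norm_half_one_plus_unit:
  assumes "cmod z = 1"
  shows "(cmod ((1 + z) / 2))\<^sup>2 = 1 - (cmod (z - 1))\<^sup>2 / 4"
    and "Re z = 1 - (cmod (z - 1))\<^sup>2 / 2"
proof -
  have "(Re z)\<^sup>2 + (Im z)\<^sup>2 = 1" using assms by (simp add: cmod_def)
  then show "(cmod ((1 + z) / 2))\<^sup>2 = 1 - (cmod (z - 1))\<^sup>2 / 4"
    and "Re z = 1 - (cmod (z - 1))\<^sup>2 / 2"
    unfolding norm_divide power_divide cmod_power2 by (simp_all add: power2_eq_square field_simps)
qed

text \<open>The sum over the box is a product of geometric sums. Multiplying the one for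
  \<open>z i\<close> by \<open>z i - 1\<close> telescopes it to \<open>z i ^ L - 1\<close>, of
  modulus at most 2; each of the other \<open>t\<close> factors is at most \<open>L\<close>.\<close>

lemma norm_box_sum_le:
  fixes z :: "nat \<Rightarrow> complex"
  assumes unit: "\<And>i. i \<le> t \<Longrightarrow> cmod (z i) = 1" and "i \<le> t"
  shows "cmod (\<Sum>\<kappa>\<in>PiE {..t} (\<lambda>_. {..<L}). \<Prod>i\<le>t. z i ^ \<kappa> i) * cmod (z i - 1) \<le> 2 * real L ^ t"
proof -
  have "cmod (\<Sum>k<L. z l ^ k) \<le> L" if "l \<le> t" for l
    using sum_norm_le[of "{..<L}" "\<lambda>k. z l ^ k" "\<lambda>_. 1"] unit[OF that] by (simp add: norm_power)
  then have "(\<Prod>l\<in>{..t} - {i}. cmod (\<Sum>k<L. z l ^ k)) \<le> (\<Prod>l\<in>{..t} - {i}. real L)"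
    by (intro prod_mono) auto
  also have "\<dots> = real L ^ t" using \<open>i \<le> t\<close> by simp
  finally have *: "(\<Prod>l\<in>{..t} - {i}. cmod (\<Sum>k<L. z l ^ k)) \<le> real L ^ t" .
  have "cmod (\<Sum>\<kappa>\<in>PiE {..t} (\<lambda>_. {..<L}). \<Prod>i\<le>t. z i ^ \<kappa> i) = (\<Prod>l\<le>t. cmod (\<Sum>k<L. z l ^ k))"
    using prod_sum_PiE[of "{..t}" "\<lambda>_. {..<L}" "\<lambda>i k. z i ^ k"] by (simp add: prod_norm)
  also have "\<dots> = cmod (\<Sum>k<L. z i ^ k) * (\<Prod>l\<in>{..t} - {i}. cmod (\<Sum>k<L. z l ^ k))"
    using \<open>i \<le> t\<close> by (intro prod.remove) simp_all
  also have "\<dots> * cmod (z i - 1) = cmod ((z i - 1) * (\<Sum>k<L. z i ^ k)) * (\<Prod>l\<in>{..t} - {i}. cmod (\<Sum>k<L. z l ^ k))"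
    by (simp add: norm_mult)
  also have "(z i - 1) * (\<Sum>k<L. z i ^ k) = z i ^ L - 1"
    by (rule power_diff_1_eq[symmetric])
  also have "cmod (z i ^ L - 1) * (\<Prod>l\<in>{..t} - {i}. cmod (\<Sum>k<L. z l ^ k)) \<le> 2 * real L ^ t"
    using * norm_triangle_ineq4[of "z i ^ L" 1] unit[OF \<open>i \<le> t\<close>]
    by (intro mult_mono prod_nonneg) (auto simp: norm_power)
  finally show ?thesis .
qed

lemma exists_poly_times_power_small:
  fixes r :: real
  assumes "0 \<le> r" "r < 1"
  shows "\<exists>N. real (N + 1) ^ m * r ^ N \<le> 1 / 6"
proof (cases "r = 0")
  case True
  then show ?thesis by (intro exI[of _ 1]) simp
next
  case False
  with assms have "((\<lambda>N. real (N + 1) ^ m * r ^ N) \<longlongrightarrow> 0) at_top"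
    by real_asymp
  then have "eventually (\<lambda>N. real (N + 1) ^ m * r ^ N < 1 / 6) at_top"
    by (rule order_tendstoD) simp
  then obtain N where "real (N + 1) ^ m * r ^ N < 1 / 6"
    unfolding eventually_sequentially by blast
  then show ?thesis by (intro exI[of _ N]) simp
qed

text \<open>
  The kernel \<open>\<Prod>i<m. ((1 + z i) / 2) ^ N\<close> with \<open>z i = circle_exp (u (h i))\<close> is exponentially small
  in \<open>N\<close> unless \<open>u\<close> is small at all \<open>h i\<close>, while its expansion has only polynomially many
  frequencies; the differences of these form the set \<open>P\<close>. The test characters are differences of
  integer combinations of \<open>a 0, \<dots>, a t\<close> with coefficients in a box, because a large average over
  such a box forces every \<open>a i\<close> to be small.
\<close>

lemma exists_finite_test_characters:
  fixes a :: "nat \<Rightarrow> 'a :: topological_ab_group_add \<Rightarrow> real_mod_int" and h :: "nat \<Rightarrow> 'a"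
  assumes a: "\<And>n. a n \<in> characters" and H: "add_subgroup H" "\<And>i. h i \<in> H"
    and \<epsilon>: "0 < \<epsilon>" "\<epsilon> \<le> 1"
  shows "\<exists>P. finite P \<and> P \<subseteq> H \<and> (\<forall>t. \<exists>E. finite E \<and> E \<noteq> {} \<and> E \<subseteq> characters \<and>
      (\<forall>u\<in>E. \<forall>i<m. circle_dist (u (h i)) < \<epsilon>) \<and>
      (\<forall>x. (\<forall>u\<in>E. circle_dist (u x) < 1) \<longrightarrow>
        (\<exists>p\<in>P. \<forall>i\<le>t. circle_dist (a i (x - p)) < 1 / Suc t)))"
proof -
  \<comment> \<open>\<open>r\<close> bounds the squared modulus of \<open>(1 + z) / 2\<close> for
    unit \<open>z\<close> at distance at least \<open>\<epsilon>\<close> from 1.\<close>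
  define r where "r = 1 - \<epsilon>\<^sup>2 / 4"
  have "\<epsilon>\<^sup>2 \<le> 1" "\<epsilon>\<^sup>2 > 0" using \<epsilon> by (auto simp: power_le_one)
  then have r: "0 \<le> r" "r < 1" by (auto simp: r_def)
  then obtain N where N: "real (N + 1) ^ m * r ^ N \<le> 1 / 6"
    using exists_poly_times_power_small by blast
  define M where "M = real (N + 1) ^ m"
  have M: "M \<ge> 1" by (simp add: M_def)
  define J where "J = PiE {..<m} (\<lambda>_. {..N})"
  have J: "finite J" "real (card J) = M"
    by (simp_all add: J_def M_def card_PiE finite_PiE)
  \<comment> \<open>The integer combination of the \<open>h i\<close> with coefficients
    \<open>j i\<close>: the inner sum is a multiple of \<open>h i\<close>.\<close>
  define g where "g j = (\<Sum>i<m. \<Sum>k<j i. h i)" for j :: "nat \<Rightarrow> nat"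
  have g: "g j \<in> H" for j
    unfolding g_def by (intro add_subgroup_sum H)
  define b where "b j = (\<Prod>i<m. real (N choose j i) / 2 ^ N)" for j
  have b: "b j \<ge> 0" "sum b J = 1" for j
    unfolding b_def J_def by (intro prod_nonneg) (simp_all add: sum_prod_binomial)
  \<comment> \<open>Fixed before \<open>t\<close> is introduced: increasing the precision changes
    the test characters but not \<open>P\<close>.\<close>
  define P where "P = (\<lambda>(j, l). g l - g j) ` (J \<times> J)"
  have P: "finite P" "P \<subseteq> H"
    using J by (auto simp: P_def intro: add_subgroup_diff[OF H(1)] g)
  have "\<exists>E. finite E \<and> E \<noteq> {} \<and> E \<subseteq> characters \<and>
      (\<forall>u\<in>E. \<forall>i<m. circle_dist (u (h i)) < \<epsilon>) \<and>
      (\<forall>x. (\<forall>u\<in>E. circle_dist (u x) < 1) \<longrightarrow>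
        (\<exists>p\<in>P. \<forall>i\<le>t. circle_dist (a i (x - p)) < 1 / Suc t))" for t
  proof -
    \<comment> \<open>With \<open>c = 1 / (4 * M)\<close> below, this makes
      \<open>2 / (c * L)\<close> smaller than \<open>1 / Suc t\<close>.\<close>
    obtain L :: nat where L: "8 * M * Suc t < L"
      using reals_Archimedean2 by blast
    moreover have "0 \<le> 8 * M * Suc t" using M by simp
    ultimately have L0: "L > 0" by (cases L) simp_all
    define K where "K = PiE {..t} (\<lambda>_. {..<L})"
    have K: "finite K" "card K = L ^ Suc t" "K \<noteq> {}"
      using L0 by (auto simp: K_def card_PiE PiE_eq_empty_iff intro: finite_PiE)
    define v where "v \<kappa> y = (\<Sum>i\<le>t. \<Sum>k<\<kappa> i. a i y)" for \<kappa> :: "nat \<Rightarrow> nat" and y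
    have v: "v \<kappa> \<in> characters" for \<kappa>
      unfolding v_def by (intro characters_sum a)
    define w where "w \<kappa> \<mu> y = v \<kappa> y - v \<mu> y" for \<kappa> \<mu> y
    have w: "w \<kappa> \<mu> \<in> characters" for \<kappa> \<mu>
      unfolding w_def by (intro characters_diff v)
    define \<phi> where "\<phi> \<kappa> y = circle_exp (v \<kappa> y)" for \<kappa> y
    have \<phi>w: "\<phi> \<kappa> y * cnj (\<phi> \<mu> y) = circle_exp (w \<kappa> \<mu> y)" for \<kappa> \<mu> y
      by (simp add: \<phi>_def w_def circle_exp_diff)
    have \<phi>_prod: "\<phi> \<kappa> y = (\<Prod>i\<le>t. circle_exp (a i y) ^ \<kappa> i)" for \<kappa> y
      by (simp add: \<phi>_def v_def circle_exp_sum)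
    define E where "E = {u \<in> (\<lambda>(\<kappa>, \<mu>). w \<kappa> \<mu>) ` (K \<times> K). \<forall>i<m. circle_dist (u (h i)) < \<epsilon>}"
    have "finite E" using K by (simp add: E_def)
    \<comment> \<open>The witness \<open>w \<kappa> \<kappa>\<close> is the zero character.\<close>
    moreover have "E \<noteq> {}"
    proof -
      obtain \<kappa> where "\<kappa> \<in> K" using K by blast
      moreover have "circle_dist (w \<kappa> \<kappa> y) < \<epsilon>" for y
        using \<epsilon> by (simp add: w_def)
      ultimately have "w \<kappa> \<kappa> \<in> E" by (auto simp: E_def)
      then show ?thesis by blast
    qed
    moreover have "E \<subseteq> characters" using w by (auto simp: E_def)
    moreover have "\<forall>u\<in>E. \<forall>i<m. circle_dist (u (h i)) < \<epsilon>" by (simp add: E_def)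
    moreover have "\<exists>p\<in>P. \<forall>i\<le>t. circle_dist (a i (x - p)) < 1 / Suc t"
      if x: "\<forall>u\<in>E. circle_dist (u x) < 1" for x
    proof -
      have near: "Re (\<phi> \<kappa> x * cnj (\<phi> \<mu> x)) \<ge> 1/2 \<or>
        (cmod (\<Sum>j\<in>J. of_real (b j) * (\<phi> \<kappa> (g j) * cnj (\<phi> \<mu> (g j)))))\<^sup>2 \<le> r ^ N"
        if \<kappa>: "\<kappa> \<in> K" "\<mu> \<in> K" for \<kappa> \<mu>
      proof (cases "w \<kappa> \<mu> \<in> E")
        case True
        with x have "circle_dist (w \<kappa> \<mu> x) < 1" by blast
        then have "(cmod (circle_exp (w \<kappa> \<mu> x) - 1))\<^sup>2 < 1"
          by (simp add: circle_dist_def power_less_one_iff abs_square_less_1)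
        then have "Re (circle_exp (w \<kappa> \<mu> x)) \<ge> 1/2"
          using norm_half_one_plus_unit(2)[OF norm_circle_exp, of "w \<kappa> \<mu> x"] by linarith
        then show ?thesis by (simp add: \<phi>w)
      next
        case False
        define z where "z i = circle_exp (w \<kappa> \<mu> (h i))" for i
        have "w \<kappa> \<mu> \<in> (\<lambda>(\<kappa>, \<mu>). w \<kappa> \<mu>) ` (K \<times> K)" using \<kappa> by auto
        \<comment> \<open>A difference outside \<open>E\<close> fails at some \<open>h i\<close>.
          The corresponding factor of the kernel is at most \<open>r ^ N\<close> after squaring, and
          the remaining factors are at most 1.\<close>
        with False obtain i where i: "i < m" "\<epsilon> \<le> cmod (z i - 1)"
          by (auto simp: E_def z_def circle_dist_def not_less)
        have "(\<Sum>j\<in>J. of_real (b j) * (\<phi> \<kappa> (g j) * cnj (\<phi> \<mu> (g j))))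
            = (\<Prod>i<m. ((1 + z i) / 2) ^ N)"
          unfolding prod_binomial_average J_def b_def \<phi>w
          by (intro sum.cong refl) (simp add: g_def z_def character_sum[OF w] circle_exp_sum)
        then have "(cmod (\<Sum>j\<in>J. of_real (b j) * (\<phi> \<kappa> (g j) * cnj (\<phi> \<mu> (g j)))))\<^sup>2
            = (\<Prod>i<m. ((cmod ((1 + z i) / 2))\<^sup>2) ^ N)"
          by (simp only: prod_norm[symmetric] prod_power_distrib[symmetric] norm_power power_mult[symmetric] mult.commute)
        also have "\<dots> = ((cmod ((1 + z i) / 2))\<^sup>2) ^ N * (\<Prod>i\<in>{..<m}-{i}. ((cmod ((1 + z i) / 2))\<^sup>2) ^ N)"
          using i(1) by (intro prod.remove) simp_all
        also have "\<dots> \<le> r ^ N * 1"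
        proof -
          have z1: "cmod (z l) = 1" for l by (simp add: z_def)
          have "\<epsilon>\<^sup>2 \<le> (cmod (z i - 1))\<^sup>2"
            using i(2) \<epsilon> by (intro power_mono) simp_all
          then have "(cmod ((1 + z i) / 2))\<^sup>2 \<le> r"
            unfolding norm_half_one_plus_unit(1)[OF z1] r_def by simp
          then have "((cmod ((1 + z i) / 2))\<^sup>2) ^ N \<le> r ^ N"
            by (rule power_mono) simp
          moreover have "(cmod ((1 + z l) / 2))\<^sup>2 \<le> 1" for l
            unfolding norm_half_one_plus_unit(1)[OF z1] by simp
          then have "((cmod ((1 + z l) / 2))\<^sup>2) ^ N \<le> 1" for l
            by (rule power_le_one[rotated]) simp
          then have "(\<Prod>i\<in>{..<m}-{i}. ((cmod ((1 + z i) / 2))\<^sup>2) ^ N) \<le> 1"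
            by (intro prod_le_1 conjI) simp_all
          ultimately show ?thesis
            using r by (intro mult_mono prod_nonneg) simp_all
        qed
        finally show ?thesis by simp
      qed
      have "\<exists>j\<in>J. \<exists>l\<in>J. (1 / (2 * card J) - 3/2 * r ^ N) * (card K)\<^sup>2
          \<le> (cmod (\<Sum>\<kappa>\<in>K. \<phi> \<kappa> (x + g j - g l)))\<^sup>2"
      proof (rule exists_large_character_sum[where \<delta> = "r ^ N" and \<phi> = \<phi> and b = b])
        show "\<phi> \<kappa> (y + z) = \<phi> \<kappa> y * \<phi> \<kappa> z" "\<phi> \<kappa> (y - z) = \<phi> \<kappa> y * cnj (\<phi> \<kappa> z)"
          "cmod (\<phi> \<kappa> y) = 1" for \<kappa> y z
          by (simp_all add: \<phi>_def character_additive[OF v] circle_exp_add circle_exp_diff)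
        show "0 \<le> r ^ N" using r by simp
        show "b j \<ge> 0" for j by (rule b(1))
        show "sum b J = 1" by (rule b(2))
      qed (rule J(1), rule near)
      then obtain j l where jl: "j \<in> J" "l \<in> J"
        "(1 / (2 * card J) - 3/2 * r ^ N) * (card K)\<^sup>2
          \<le> (cmod (\<Sum>\<kappa>\<in>K. \<phi> \<kappa> (x + g j - g l)))\<^sup>2"
        by blast
      then have big: "(1 / (2 * M) - 3/2 * r ^ N) * (card K)\<^sup>2
          \<le> (cmod (\<Sum>\<kappa>\<in>K. \<phi> \<kappa> (x + g j - g l)))\<^sup>2"
        by (simp add: J(2))
      define p where "p = g l - g j"
      have p: "p \<in> P" "x + g j - g l = x - p" using jl by (auto simp: P_def p_def)
      \<comment> \<open>The choice of \<open>N\<close> bounds the error \<open>3/2 * r ^ N\<close>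
        by \<open>1 / (4 * M)\<close>, half of the main term \<open>1 / (2 * M)\<close>;
        \<open>c\<close> is what remains.\<close>
      define c where "c = 1 / (4 * M)"
      have c: "0 < c" "c \<le> 1" using M by (simp_all add: c_def)
      have "r ^ N \<le> 1 / (6 * M)" using N M by (simp add: M_def field_simps)
      then have "c \<le> 1 / (2 * M) - 3/2 * r ^ N"
        using M by (simp add: c_def field_simps)
      then have "c * (card K)\<^sup>2 \<le> (1 / (2 * M) - 3/2 * r ^ N) * (card K)\<^sup>2"
        by (rule mult_right_mono) simp
      also have "\<dots> \<le> (cmod (\<Sum>\<kappa>\<in>K. \<phi> \<kappa> (x - p)))\<^sup>2"
        using big unfolding p(2) .
      finally have "c * (card K)\<^sup>2 \<le> (cmod (\<Sum>\<kappa>\<in>K. \<phi> \<kappa> (x - p)))\<^sup>2" .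
      \<comment> \<open>Weakening \<open>c\<close> to its square allows a square root to be taken
        without introducing the root of \<open>c\<close>.\<close>
      moreover have "c\<^sup>2 * (card K)\<^sup>2 \<le> c * (card K)\<^sup>2"
        using c by (intro mult_right_mono) (auto simp: power2_eq_square mult_left_le)
      ultimately have "(c * card K)\<^sup>2 \<le> (cmod (\<Sum>\<kappa>\<in>K. \<phi> \<kappa> (x - p)))\<^sup>2"
        by (simp add: power_mult_distrib)
      then have large: "c * L ^ Suc t \<le> cmod (\<Sum>\<kappa>\<in>K. \<phi> \<kappa> (x - p))"
        unfolding K(2) by (rule power2_le_imp_le) simp
      have "circle_dist (a i (x - p)) < 1 / Suc t" if "i \<le> t" for i
      proof -
        let ?d = "circle_dist (a i (x - p))"
        \<comment> \<open>The lower bound has order \<open>L ^ Suc t\<close>, whereas the box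
          estimate allows only \<open>2 * L ^ t\<close>; cancelling leaves
          \<open>c * L * ?d \<le> 2\<close>.\<close>
        have "c * L ^ Suc t * ?d \<le> cmod (\<Sum>\<kappa>\<in>K. \<phi> \<kappa> (x - p)) * ?d"
          using large by (intro mult_right_mono) simp_all
        also have "\<dots> \<le> 2 * real L ^ t"
          unfolding \<phi>_prod K_def circle_dist_def using that by (intro norm_box_sum_le) simp_all
        finally have "(c * L * ?d) * real L ^ t \<le> 2 * real L ^ t"
          by (simp add: mult_ac)
        then have "c * L * ?d \<le> 2" using L0 by simp
        then have "L * ?d \<le> 8 * M" using M by (simp add: c_def field_simps)
        then have "L * ?d * Suc t \<le> 8 * M * Suc t" by (rule mult_right_mono) simp
        also note L
        finally have "L * (?d * Suc t) < L * 1" by simp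
        then have "?d * Suc t < 1" using L0 by simp
        then show ?thesis by (simp add: field_simps)
      qed
      with p(1) show ?thesis by blast
    qed
    ultimately show ?thesis by blast
  qed
  with P show ?thesis by blast
qed

section \<open>From test sets to a characterizing sequence\<close>

text \<open>One index with \<open>a i y\<close> nonzero suffices once \<open>t\<close> is large. The
  numerator 2 accommodates two approximations, each with error below
  \<open>1 / Suc t\<close>.\<close>

lemma eventually_separated:
  fixes a :: "nat \<Rightarrow> 'a :: topological_ab_group_add \<Rightarrow> real_mod_int"
  assumes sep: "\<And>y. (\<And>n. a n y = 0) \<Longrightarrow> y = 0" and "y \<noteq> 0"
  shows "\<forall>\<^sub>F t in sequentially. \<exists>i\<le>t. 2 / Suc t \<le> circle_dist (a i y)"
proof -
  obtain i where i: "a i y \<noteq> 0" using sep \<open>y \<noteq> 0\<close> by blast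
  then have "circle_dist (a i y) / 2 > 0"
    using circle_dist_nonneg[of "a i y"] circle_dist_eq_0_iff[of "a i y"] by linarith
  then obtain n where n: "1 / Suc n < circle_dist (a i y) / 2"
    using nat_approx_posE by blast
  have "2 / Suc t \<le> circle_dist (a i y)" if "t \<ge> n" for t
  proof -
    have "1 / Suc t \<le> 1 / Suc n" using that by (intro divide_left_mono) simp_all
    with n show ?thesis by simp
  qed
  then have "\<forall>t\<ge>max n i. \<exists>i\<le>t. 2 / Suc t \<le> circle_dist (a i y)"
    by (meson max.boundedE)
  then show ?thesis unfolding eventually_sequentially by blast
qed

lemma add_subgroup_characterized_if_countable:
  fixes a :: "nat \<Rightarrow> 'a :: topological_ab_group_add \<Rightarrow> real_mod_int"
    and H :: "'a set"
  assumes a: "\<And>n. a n \<in> characters" and sep: "\<And>y. (\<And>n. a n y = 0) \<Longrightarrow> y = 0"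
    and H: "add_subgroup H" "countable H"
  shows "\<exists>u. range u \<subseteq> characters \<and> H = char_seq_null u"
proof -
  define h where "h = from_nat_into H"
  have "H \<noteq> {}" using H(1) by (auto simp: add_subgroup_def)
  then have h: "range h = H"
    unfolding h_def using H(2) by (rule range_from_nat_into)
  \<comment> \<open>Stage \<open>n\<close> controls the first \<open>n\<close> elements of
    \<open>H\<close> with tolerance \<open>1 / Suc n\<close>.\<close>
  have "\<exists>P. finite P \<and> P \<subseteq> H \<and> (\<forall>t. \<exists>E. finite E \<and> E \<noteq> {} \<and> E \<subseteq> characters \<and>
      (\<forall>u\<in>E. \<forall>i<n. circle_dist (u (h i)) < 1 / real (Suc n)) \<and>
      (\<forall>x. (\<forall>u\<in>E. circle_dist (u x) < 1) \<longrightarrow>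
        (\<exists>p\<in>P. \<forall>i\<le>t. circle_dist (a i (x - p)) < 1 / real (Suc t))))" for n
    using h by (intro exists_finite_test_characters a H(1)) auto
  then obtain P where P: "\<And>n. finite (P n)" "\<And>n. P n \<subseteq> H" and
    "\<And>n t. \<exists>E. finite E \<and> E \<noteq> {} \<and> E \<subseteq> characters \<and>
      (\<forall>u\<in>E. \<forall>i<n. circle_dist (u (h i)) < 1 / real (Suc n)) \<and>
      (\<forall>x. (\<forall>u\<in>E. circle_dist (u x) < 1) \<longrightarrow>
        (\<exists>p\<in>P n. \<forall>i\<le>t. circle_dist (a i (x - p)) < 1 / real (Suc t)))"
    by metis
  then obtain E' where E': "\<And>n t. finite (E' n t) \<and> E' n t \<noteq> {} \<and> E' n t \<subseteq> characters \<and>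
      (\<forall>u\<in>E' n t. \<forall>i<n. circle_dist (u (h i)) < 1 / real (Suc n)) \<and>
      (\<forall>x. (\<forall>u\<in>E' n t. circle_dist (u x) < 1) \<longrightarrow>
        (\<exists>p\<in>P n. \<forall>i\<le>t. circle_dist (a i (x - p)) < 1 / real (Suc t)))"
    by metis
  \<comment> \<open>The nonzero gaps between consecutive stages; finiteness gives one precision that
    detects all of them.\<close>
  define Q where "Q n = (\<lambda>(p, q). q - p) ` (P n \<times> P (Suc n)) - {0}" for n
  have "\<forall>\<^sub>F t in sequentially. \<forall>y\<in>Q n. \<exists>i\<le>t. 2 / Suc t \<le> circle_dist (a i y)" for n
  proof (intro eventually_ball_finite ballI)
    show "finite (Q n)" using P(1) by (simp add: Q_def)
    fix y assume "y \<in> Q n"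
    then have "y \<noteq> 0" by (simp add: Q_def)
    with sep show "\<forall>\<^sub>F t in sequentially. \<exists>i\<le>t. 2 / Suc t \<le> circle_dist (a i y)"
      by (rule eventually_separated)
  qed
  then have "\<exists>T. \<forall>t\<ge>T. \<forall>y\<in>Q n. \<exists>i\<le>t. 2 / Suc t \<le> circle_dist (a i y)" for n
    unfolding eventually_sequentially .
  then obtain T where T: "\<And>n t y. t \<ge> T n \<Longrightarrow> y \<in> Q n \<Longrightarrow> \<exists>i\<le>t. 2 / Suc t \<le> circle_dist (a i y)"
    by metis
  \<comment> \<open>Monotonicity of \<open>\<tau>\<close> lets the precision at stage \<open>n\<close> also hold at stage \<open>n + 1\<close>.\<close>
  define \<tau> where "\<tau> n = n + (\<Sum>k\<le>n. T k)" for n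
  have \<tau>: "n \<le> \<tau> n" "T n \<le> \<tau> n" "\<tau> n \<le> \<tau> (Suc n)" for n
    by (simp_all add: \<tau>_def trans_le_add2 member_le_sum)
  define E where "E n = E' n (\<tau> n)" for n
  have E: "finite (E n)" "E n \<noteq> {}" "E n \<subseteq> characters" for n
    using E'[of n "\<tau> n"] by (simp_all add: E_def)
  have E_small: "circle_dist (u (h i)) < 1 / real (Suc n)" if "u \<in> E n" "i < n" for u i n
    using E'[of n "\<tau> n"] that unfolding E_def by blast
  have E_test: "\<exists>p\<in>P n. \<forall>i\<le>\<tau> n. circle_dist (a i (x - p)) < 1 / Suc (\<tau> n)"
    if "\<forall>u\<in>E n. circle_dist (u x) < 1" for x n
    using E'[of n "\<tau> n"] that unfolding E_def by blast
  have in_H: "x \<in> H" if x: "\<And>n u. n \<ge> n0 \<Longrightarrow> u \<in> E n \<Longrightarrow> circle_dist (u x) < 1" for x n0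
  proof -
    have "\<forall>n\<in>{n0..}. \<exists>p. p \<in> P n \<and> (\<forall>i\<le>\<tau> n. circle_dist (a i (x - p)) < 1 / Suc (\<tau> n))"
      using E_test x by (metis atLeast_iff)
    from bchoice[OF this] obtain p where p: "\<And>n. n \<ge> n0 \<Longrightarrow> p n \<in> P n"
      "\<And>n i. n \<ge> n0 \<Longrightarrow> i \<le> \<tau> n \<Longrightarrow> circle_dist (a i (x - p n)) < 1 / Suc (\<tau> n)"
      by auto
    \<comment> \<open>Both approximants are close to \<open>x\<close>, so their difference is tested
      below \<open>2 / Suc (\<tau> n)\<close>, which no element of \<open>Q n\<close>
      allows.\<close>
    have step: "p (Suc n) = p n" if n: "n \<ge> n0" for n
    proof (rule ccontr)
      assume "p (Suc n) \<noteq> p n"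
      then have "p (Suc n) - p n \<in> Q n"
        using p(1)[of n] p(1)[of "Suc n"] n by (force simp: Q_def)
      then obtain i where i: "i \<le> \<tau> n" "2 / Suc (\<tau> n) \<le> circle_dist (a i (p (Suc n) - p n))"
        using T[OF \<tau>(2)] by blast
      have "p (Suc n) - p n = (x - p n) - (x - p (Suc n))" by simp
      then have "a i (p (Suc n) - p n) = a i (x - p n) - a i (x - p (Suc n))"
        using character_additive(2)[OF a] by metis
      then have "circle_dist (a i (p (Suc n) - p n))
          \<le> circle_dist (a i (x - p n)) + circle_dist (a i (x - p (Suc n)))"
        by (simp only: circle_dist_diff_le)
      moreover have "circle_dist (a i (x - p n)) < 1 / Suc (\<tau> n)"
        using n i(1) by (intro p(2))
      moreover have "circle_dist (a i (x - p (Suc n))) < 1 / Suc (\<tau> (Suc n))"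
        using n i(1) \<tau>(3)[of n] by (intro p(2)) simp_all
      moreover have "1 / Suc (\<tau> (Suc n)) \<le> 1 / Suc (\<tau> n)"
        using \<tau>(3)[of n] by (intro divide_left_mono) simp_all
      ultimately show False using i(2) by simp
    qed
    have p_eq: "p n = p n0" if "n \<ge> n0" for n
      using that by (induction n rule: dec_induct) (simp_all add: step)
    have "a i (x - p n0) = 0" for i
    proof (rule ccontr)
      assume "a i (x - p n0) \<noteq> 0"
      then have "circle_dist (a i (x - p n0)) > 0"
        using circle_dist_nonneg[of "a i (x - p n0)"] circle_dist_eq_0_iff[of "a i (x - p n0)"]
        by linarith
      then obtain k where k: "1 / Suc k < circle_dist (a i (x - p n0))"
        using nat_approx_posE by blast
      \<comment> \<open>Since \<open>n \<le> \<tau> n\<close>, this stage tests the index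
        \<open>i\<close> with precision at least \<open>1 / Suc k\<close>.\<close>
      define n where "n = max n0 (max i k)"
      have n: "n \<ge> n0" "i \<le> \<tau> n" "k \<le> \<tau> n"
        using \<tau>(1)[of n] by (auto simp: n_def)
      have "circle_dist (a i (x - p n0)) < 1 / Suc (\<tau> n)"
        using p(2)[OF n(1,2)] p_eq[OF n(1)] by simp
      also have "\<dots> \<le> 1 / Suc k"
        using n(3) by (intro divide_left_mono) simp_all
      finally show False using k by simp
    qed
    then have "x - p n0 = 0" by (rule sep)
    then show "x \<in> H" using p(1)[of n0] P(2) by auto
  qed
  \<comment> \<open>Characters are tagged with their stage, so one that occurs in several
    \<open>E n\<close> is listed once for each. Nonempty stages make \<open>I\<close> infinite and
    hence enumerable by a bijection.\<close>
  define I where "I = Sigma UNIV E"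
  have "countable I" unfolding I_def
    by (rule countable_SIGMA[OF countableI_type countable_finite[OF E(1)]])
  moreover have "infinite I"
  proof
    assume "finite I"
    then have "finite (fst ` I)" by simp
    moreover have "fst ` I = UNIV" using E(2) by (force simp: I_def)
    ultimately show False by simp
  qed
  ultimately have bij: "bij_betw (from_nat_into I) UNIV I"
    by (rule bij_betw_from_nat_into)
  define \<nu> where "\<nu> k = fst (from_nat_into I k)" for k
  define u where "u k = snd (from_nat_into I k)" for k
  have u: "u k \<in> E (\<nu> k)" for k
  proof -
    have "from_nat_into I k \<in> I" using bij_betwE[OF bij] by blast
    then have "(\<nu> k, u k) \<in> I" by (simp add: u_def \<nu>_def)
    then show ?thesis by (simp add: I_def)
  qed
  have onto: "\<exists>k. \<nu> k = n \<and> u k = w" if "w \<in> E n" for n w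
  proof -
    have "(n, w) \<in> range (from_nat_into I)"
      using bij that by (simp add: bij_betw_def I_def)
    then obtain k where "from_nat_into I k = (n, w)" by (metis imageE)
    then show ?thesis by (intro exI[of _ k]) (simp add: \<nu>_def u_def)
  qed
  \<comment> \<open>The enumeration is injective and each stage is finite, so any bounded range of
    stages is visited only finitely often.\<close>
  have \<nu>: "\<forall>\<^sub>F k in sequentially. n < \<nu> k" for n
  proof -
    have "finite (from_nat_into I -` Sigma {..n} E)"
      using bij E(1) by (intro finite_vimageI finite_SigmaI) (simp_all add: bij_betw_def)
    moreover have "{k. \<not> n < \<nu> k} \<subseteq> from_nat_into I -` Sigma {..n} E"
    proof
      fix k assume "k \<in> {k. \<not> n < \<nu> k}"
      then have "(\<nu> k, u k) \<in> Sigma {..n} E" using u by simp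
      then show "k \<in> from_nat_into I -` Sigma {..n} E" by (simp add: \<nu>_def u_def)
    qed
    ultimately have "finite {k. \<not> n < \<nu> k}" by (rule rev_finite_subset)
    then show ?thesis
      by (simp add: cofinite_eq_sequentially[symmetric] eventually_cofinite)
  qed
  have "H = char_seq_null u"
  proof (intro equalityI subsetI)
    fix x assume "x \<in> H"
    then obtain i where i: "x = h i" using h by blast
    have "(\<lambda>k. circle_dist (u k x)) \<longlonglongrightarrow> 0"
    proof (rule tendstoI)
      fix e :: real assume "e > 0"
      then obtain n where n: "1 / real (Suc n) < e" using nat_approx_posE by blast
      show "\<forall>\<^sub>F k in sequentially. dist (circle_dist (u k x)) 0 < e"
        using \<nu>[of "max i n"]
      proof eventually_elim
        case (elim k)
        have "circle_dist (u k x) < 1 / Suc (\<nu> k)"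
          unfolding i using elim by (intro E_small u) simp
        also have "\<dots> \<le> 1 / real (Suc n)"
          using elim by (intro divide_left_mono) simp_all
        finally show ?case using n by simp
      qed
    qed
    then show "x \<in> char_seq_null u"
      by (simp add: char_seq_null_def tendsto_0_iff_circle_dist)
  next
    fix x assume "x \<in> char_seq_null u"
    then have "(\<lambda>k. circle_dist (u k x)) \<longlonglongrightarrow> 0"
      by (simp add: char_seq_null_def tendsto_0_iff_circle_dist)
    then have "\<forall>\<^sub>F k in sequentially. circle_dist (u k x) < 1"
      by (rule order_tendstoD) simp
    then obtain k0 where k0: "\<And>k. k \<ge> k0 \<Longrightarrow> circle_dist (u k x) < 1"
      unfolding eventually_sequentially by blast
    show "x \<in> H"
    proof (rule in_H)
      \<comment> \<open>The threshold exceeds the stage of each of the first \<open>k0\<close>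
        entries, so every test character of stage \<open>n\<close> is listed at position
        \<open>k0\<close> or later.\<close>
      fix n w assume n: "Suc (\<Sum>k<k0. \<nu> k) \<le> n" and w: "w \<in> E n"
      obtain k where k: "\<nu> k = n" "u k = w" using onto[OF w] by blast
      have "k \<ge> k0"
      proof (rule ccontr)
        assume "\<not> k \<ge> k0"
        then have "\<nu> k \<le> (\<Sum>k<k0. \<nu> k)" by (intro member_le_sum) simp_all
        with n k show False by simp
      qed
      then show "circle_dist (w x) < 1" using k0 k(2) by blast
    qed
  qed
  moreover have "range u \<subseteq> characters" using u E(3) by blast
  ultimately show ?thesis by blast
qed

section \<open>Separation from a countable null set, and the equivalence\<close>

text \<open>The \<open>u n\<close> may have a nontrivial common kernel; being countable, it is
  removed by adjoining, for each nonzero point of the null set, one character that does not vanish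
  there.\<close>

lemma countably_separated_if_characterized:
  fixes u :: "nat \<Rightarrow> 'a :: {topological_ab_group_add, t2_space} \<Rightarrow> real_mod_int"
  assumes MAP: "Hausdorff_space (bohr_topology :: 'a topology)"
    and u: "range u \<subseteq> characters" and null: "countable (char_seq_null u)"
  shows "\<exists>a :: nat \<Rightarrow> 'a \<Rightarrow> real_mod_int. range a \<subseteq> characters \<and> (\<forall>y. (\<forall>n. a n y = 0) \<longrightarrow> y = 0)"
proof -
  have "\<exists>f. f \<in> characters \<and> f z \<noteq> 0" if "z \<noteq> 0" for z :: 'a
    using exists_nonvanishing_character[OF MAP that] by blast
  then obtain f where f: "\<And>z :: 'a. z \<noteq> 0 \<Longrightarrow> f z \<in> characters \<and> f z z \<noteq> 0"
    by metis
  \<comment> \<open>The common kernel of the \<open>u n\<close> is contained in the countable null set.\<close>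
  define A where "A = range u \<union> f ` (char_seq_null u - {0})"
  have "countable A" "A \<noteq> {}"
    using null by (simp_all add: A_def)
  then have range: "range (from_nat_into A) = A"
    by (simp add: range_from_nat_into)
  have "A \<subseteq> characters"
    using u f by (auto simp: A_def)
  moreover have "y = 0" if y: "\<forall>n. from_nat_into A n y = 0" for y
  proof (rule ccontr)
    assume "y \<noteq> 0"
    have A0: "g y = 0" if "g \<in> A" for g
    proof -
      from that range have "g \<in> range (from_nat_into A)" by simp
      with y show ?thesis by blast
    qed
    have "u n y = 0" for n by (rule A0) (simp add: A_def)
    then have "y \<in> char_seq_null u" by (simp add: char_seq_null_def)
    with \<open>y \<noteq> 0\<close> have "f y \<in> A" by (simp add: A_def)
    then have "f y y = 0" by (rule A0)
    with f[OF \<open>y \<noteq> 0\<close>] show False by simp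
  qed
  ultimately show ?thesis
    by (intro exI[of _ "from_nat_into A"] conjI allI impI) (simp_all only: range)
qed

theorem corollary1p6:
  assumes MAP: "Hausdorff_space (bohr_topology :: 'a :: {topological_ab_group_add, t2_space} topology)"
  shows "((\<forall>H :: 'a set. add_subgroup H \<and> countable H \<longrightarrow>
            (\<exists>u :: nat \<Rightarrow> 'a \<Rightarrow> real_mod_int. range u \<subseteq> characters \<and> H = char_seq_null u))
          \<longleftrightarrow>
          (\<exists>H :: 'a set. add_subgroup H \<and> countable H \<and>
            (\<exists>u :: nat \<Rightarrow> 'a \<Rightarrow> real_mod_int. range u \<subseteq> characters \<and> H = char_seq_null u)))
       \<and> ((\<exists>H :: 'a set. add_subgroup H \<and> countable H \<and>
            (\<exists>u :: nat \<Rightarrow> 'a \<Rightarrow> real_mod_int. range u \<subseteq> characters \<and> H = char_seq_null u))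
          \<longleftrightarrow>
          countable_pseudocharacter (bohr_topology :: 'a topology))"
    (is "(?every \<longleftrightarrow> ?some) \<and> (_ \<longleftrightarrow> ?pseudo)")
proof -
  \<comment> \<open>Countable separation replaces the pseudocharacter condition and closes the cycle
    from \<open>?every\<close> to \<open>?some\<close> to \<open>?separated\<close> and back; the
    first implication uses the trivial subgroup.\<close>
  let ?separated = "\<exists>a :: nat \<Rightarrow> 'a \<Rightarrow> real_mod_int.
    range a \<subseteq> characters \<and> (\<forall>y. (\<forall>n. a n y = 0) \<longrightarrow> y = 0)"
  have pseudo: "?pseudo \<longleftrightarrow> ?separated"
    unfolding countable_pseudocharacter_def topspace_bohr_topology
      bohr_gdelta_singleton_iff_countably_separated by simp
  have "?some" if "?every"
  proof -
    have "add_subgroup {0 :: 'a}" by (simp add: add_subgroup_def)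
    with that show ?thesis by (intro exI[of _ "{0}"]) simp
  qed
  moreover have "?separated" if "?some"
    using that countably_separated_if_characterized[OF MAP] by blast
  moreover have "?every" if "?separated"
  proof (intro allI impI)
    fix H :: "'a set" assume H: "add_subgroup H \<and> countable H"
    from that obtain a :: "nat \<Rightarrow> 'a \<Rightarrow> real_mod_int"
      where "range a \<subseteq> characters" "\<forall>y. (\<forall>n. a n y = 0) \<longrightarrow> y = 0" by blast
    then show "\<exists>u :: nat \<Rightarrow> 'a \<Rightarrow> real_mod_int. range u \<subseteq> characters \<and> H = char_seq_null u"
      using H by (intro add_subgroup_characterized_if_countable[of a]) auto
  qed
  ultimately show ?thesis unfolding pseudo by blast
qed

end
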